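(* Let $\Gamma$ be a weighted digraph with forest dimension $v$, let $K$ be an undominated knot of $\Gamma$, and let $\bar J=(\bar J_{ij})=Q_{n-v}/\varepsilon(\mathcal F_{n-v})$. Then: 1. $\bar J$ is stochastic: $\bar J_{ij}\ge0$ and $\sum_{k=1}^n\bar J_{ik}=1$ for all $i,j$. 2. $\bar J_{ij}\neq0$ if and only if $j\in\tilde K$ and $i$ is reachable from $j$ in $\Gamma$. 3. If $j\in K$, then for every $i\in V(\Gamma)$, $\bar J_{ij}=\varepsilon(\mathcal T^j)\varepsilon(\mathcal P^{K\to i})/\varepsilon(\mathcal F_{n-v})$; furthermore, if $i\in K^+$ then $\bar J_{ij}=\bar J_{jj}=\varepsilon(\mathcal T^j)/\varepsilon(\mathcal T)$. 4. $\sum_{j\in K}\bar J_{jj}=1$; in particular, if $j$ is an undominated vertex, $\bar J_{jj}=1$. 5. If $j_1,j_2\in K$, the $j_2$-th column of $\bar J$ equals $\bigl(\varepsilon(\mathcal T^{j_2})/\varepsilon(\mathcal T^{j_1})\bigr)$ times its $j_1$-th column.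
   Context: $\Gamma$: loopless digraph on $V(\Gamma)=\{1,\dots,n\}$, $n>1$, arc weights $\varepsilon_{ij}>0$. Weight of a subgraph = product of its arc weights (1 if no arcs); weight of a set of subgraphs = sum of weights (0 if empty). $w$ is reachable from $z$ if $w=z$ or there is a directed path from $z$ to $w$. A vertex is undominated if its indegree is 0. A diverging forest is a digraph without circuits with all indegrees $\le1$; roots are indegree-0 vertices; each weak component is a tree diverging from a root. A maximum out forest of $\Gamma$ is a spanning diverging forest with the maximum number of arcs; its number of roots is the forest dimension $v$. $\mathcal F_k$: spanning diverging forests of $\Gamma$ with $k$ arcs; $\mathcal F_k^{j\to i}$: those in which $i$ lies in the tree rooted at $j$; $Q_{n-v}=(\varepsilon(\mathcal F^{j\to i}_{n-v}))_{i,j}$. An undominated knot is a nonempty $K\subseteq V(\Gamma)$ whose vertices are mutually reachable with no arc from outside $K$ into $K$. $\tilde K$: union of all undominated knots; $K^+$: vertices reachable from $K$ and unreachable from all other undominated knots. $\Gamma_K$: induced subgraph on $K$; $\Gamma_{-K}$: spanning subgraph with arc set $E(\Gamma)\setminus E(\Gamma_K)$. $\mathcal T$: spanning diverging trees of $\Gamma_K$; $\mathcal T^j$: those diverging from $j$; $\mathcal P$: maximum out forests of $\Gamma_{-K}$; $\mathcal P^{K\to i}$: those in which $i$ is reachable from some vertex of $K$. *)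

theory Defs
  imports Complex_Main "Graph_Theory.Digraph_Component"
begin

definition undominated_verts :: "('a, 'b) pre_digraph \<Rightarrow> 'a set" where
  "undominated_verts G = {v \<in> verts G. in_degree G v = 0}"

text \<open>The weight of a single arc depends only on its two ends: \<open>\<epsilon> i j\<close> is the weight of the arc
  from \<open>i\<close> to \<open>j\<close>.\<close>

definition weight :: "('a \<Rightarrow> 'a \<Rightarrow> real) \<Rightarrow> ('a, 'b) pre_digraph \<Rightarrow> real" where
  "weight \<epsilon> H = (\<Prod>e\<in>arcs H. \<epsilon> (tail H e) (head H e))"

definition set_weight :: "('a \<Rightarrow> 'a \<Rightarrow> real) \<Rightarrow> ('a, 'b) pre_digraph set \<Rightarrow> real" where
  "set_weight \<epsilon> A = (\<Sum>H\<in>A. weight \<epsilon> H)"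

text \<open>The library predicate \<^const>\<open>forest\<close> says that there is no directed cycle; it does
  not bound the indegrees. The roots of a diverging forest are its undominated vertices.\<close>

definition diverging_forest :: "('a, 'b) pre_digraph \<Rightarrow> bool" where
  "diverging_forest H \<longleftrightarrow> forest H \<and> (\<forall>v\<in>verts H. in_degree H v \<le> 1)"

abbreviation (input) roots :: "('a, 'b) pre_digraph \<Rightarrow> 'a set" where
  "roots \<equiv> undominated_verts"

definition diverging_tree :: "('a, 'b) pre_digraph \<Rightarrow> bool" where
  "diverging_tree H \<longleftrightarrow> diverging_forest H \<and> Digraph_Component.connected H"

definition weak_component :: "('a, 'b) pre_digraph \<Rightarrow> 'a \<Rightarrow> 'a set" where
  "weak_component H j = {i. j \<rightarrow>\<^sup>*\<^bsub>with_proj (mk_symmetric H)\<^esub> i}"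

definition spanning_forests :: "('a, 'b) pre_digraph \<Rightarrow> ('a, 'b) pre_digraph set" where
  "spanning_forests G = {H. spanning H G \<and> diverging_forest H}"

definition max_out_forests :: "('a, 'b) pre_digraph \<Rightarrow> ('a, 'b) pre_digraph set" where
  "max_out_forests G = {H \<in> spanning_forests G.
     \<forall>H'\<in>spanning_forests G. card (arcs H') \<le> card (arcs H)}"

text \<open>In a finite digraph the value below is unique: a spanning diverging forest with \<open>k\<close> arcs has
  exactly \<open>card (verts G) - k\<close> roots.\<close>

definition forest_dimension :: "('a, 'b) pre_digraph \<Rightarrow> nat" where
  "forest_dimension G = (THE d. \<exists>H\<in>max_out_forests G. card (roots H) = d)"

definition forests :: "('a, 'b) pre_digraph \<Rightarrow> nat \<Rightarrow> ('a, 'b) pre_digraph set" where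
  "forests G k = {H \<in> spanning_forests G. card (arcs H) = k}"

definition forests_to :: "('a, 'b) pre_digraph \<Rightarrow> nat \<Rightarrow> 'a \<Rightarrow> 'a \<Rightarrow> ('a, 'b) pre_digraph set" where
  "forests_to G k j i = {H \<in> forests G k. j \<in> roots H \<and> i \<in> weak_component H j}"

text \<open>In the matrix, the row index \<open>i\<close> is the vertex lying in the tree and the column index \<open>j\<close> is
  the root of that tree.\<close>

definition forest_matrix ::
  "('a \<Rightarrow> 'a \<Rightarrow> real) \<Rightarrow> ('a, 'b) pre_digraph \<Rightarrow> nat \<Rightarrow> 'a \<Rightarrow> 'a \<Rightarrow> real" where
  "forest_matrix \<epsilon> G k i j = set_weight \<epsilon> (forests_to G k j i)"

definition undominated_knot :: "('a, 'b) pre_digraph \<Rightarrow> 'a set \<Rightarrow> bool" where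
  "undominated_knot G K \<longleftrightarrow> K \<noteq> {} \<and> K \<subseteq> verts G \<and>
     (\<forall>u\<in>K. \<forall>w\<in>K. u \<rightarrow>\<^sup>*\<^bsub>G\<^esub> w) \<and>
     (\<forall>u\<in>verts G - K. \<forall>w\<in>K. \<not> u \<rightarrow>\<^bsub>G\<^esub> w)"

definition knot_verts :: "('a, 'b) pre_digraph \<Rightarrow> 'a set" where
  "knot_verts G = \<Union>{K. undominated_knot G K}"

definition knot_plus :: "('a, 'b) pre_digraph \<Rightarrow> 'a set \<Rightarrow> 'a set" where
  "knot_plus G K = {i \<in> verts G. (\<exists>u\<in>K. u \<rightarrow>\<^sup>*\<^bsub>G\<^esub> i) \<and>
     (\<forall>K'. undominated_knot G K' \<and> K' \<noteq> K \<longrightarrow> (\<forall>u\<in>K'. \<not> u \<rightarrow>\<^sup>*\<^bsub>G\<^esub> i))}"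

definition remove_knot :: "('a, 'b) pre_digraph \<Rightarrow> 'a set \<Rightarrow> ('a, 'b) pre_digraph" where
  "remove_knot G K = G\<lparr>arcs := arcs G - arcs (G \<restriction> K)\<rparr>"

definition knot_trees :: "('a, 'b) pre_digraph \<Rightarrow> 'a set \<Rightarrow> ('a, 'b) pre_digraph set" where
  "knot_trees G K = {H. spanning H (G \<restriction> K) \<and> diverging_tree H}"

definition knot_trees_from ::
  "('a, 'b) pre_digraph \<Rightarrow> 'a set \<Rightarrow> 'a \<Rightarrow> ('a, 'b) pre_digraph set" where
  "knot_trees_from G K j = {H \<in> knot_trees G K. j \<in> roots H}"

definition max_out_forests_reaching ::
  "('a, 'b) pre_digraph \<Rightarrow> 'a set \<Rightarrow> 'a \<Rightarrow> ('a, 'b) pre_digraph set" where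
  "max_out_forests_reaching G K i =
     {H \<in> max_out_forests (remove_knot G K). \<exists>u\<in>K. u \<rightarrow>\<^sup>*\<^bsub>H\<^esub> i}"

end

theory Submission
  imports Defs
begin

text \<open>Every undominated knot contains a root of every spanning diverging forest, and any choice of one
  root per knot is the root set of some forest (a shortest-path forest). Hence the maximum out forests
  are those with exactly one root in each undominated knot and no root elsewhere. As no arc enters
  \<open>K\<close> from outside, deleting and reinserting the arcs inside \<open>K\<close> is a
  weight-multiplicative bijection between the maximum out forests with root \<open>j \<in> K\<close> and the pairs of a
  spanning tree of \<open>K\<close> rooted at \<open>j\<close> and a maximum out forest of the remaining digraph; it preserves
  whether \<open>i\<close> is reached from \<open>K\<close>. All parts follow by summing over these pairs.

  Spanning subdigraphs of \<open>G\<close> are represented by their arc sets.\<close>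

section \<open>Diverging forests as arc sets: their roots, and forests with prescribed roots\<close>

definition ends :: "('a, 'b) pre_digraph \<Rightarrow> 'b set \<Rightarrow> 'a rel" where
  "ends G F = (\<lambda>e. (tail G e, head G e)) ` F"

text \<open>Injectivity of \<open>head G\<close> on \<open>F\<close> is the bound 1 on indegrees,
  and acyclicity of the arc relation excludes circuits. Working with arc sets lets forests be cut
  and glued by set operations.\<close>

definition branching :: "('a, 'b) pre_digraph \<Rightarrow> 'b set \<Rightarrow> bool" where
  "branching G F \<longleftrightarrow> inj_on (head G) F \<and> acyclic (ends G F)"

definition branchings :: "('a, 'b) pre_digraph \<Rightarrow> 'b set set" where
  "branchings G = {F. F \<subseteq> arcs G \<and> branching G F}"

definition max_branchings :: "('a, 'b) pre_digraph \<Rightarrow> 'b set set" where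
  "max_branchings G = {F \<in> branchings G. \<forall>F'\<in>branchings G. card F' \<le> card F}"

definition arcs_weight :: "('a \<Rightarrow> 'a \<Rightarrow> real) \<Rightarrow> ('a, 'b) pre_digraph \<Rightarrow> 'b set \<Rightarrow> real" where
  "arcs_weight \<epsilon> G F = (\<Prod>e\<in>F. \<epsilon> (tail G e) (head G e))"

lemma ends_arcs_update [simp]: "ends (G\<lparr>arcs := B\<rparr>) = ends G"
  and ends_induce [simp]: "ends (G \<restriction> K) = ends G"
  and arcs_ends_eq_ends: "arcs_ends G = ends G (arcs G)"
  by (auto simp: ends_def arcs_ends_conv fun_eq_iff)

lemma branching_arcs_update [simp]: "branching (G\<lparr>arcs := B\<rparr>) = branching G"
  and branching_induce [simp]: "branching (G \<restriction> K) = branching G"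
  by (auto simp: branching_def fun_eq_iff)

lemma ends_mono: "F \<subseteq> F' \<Longrightarrow> ends G F \<subseteq> ends G F'"
  by (auto simp: ends_def)

lemma ends_Un: "ends G (F \<union> F') = ends G F \<union> ends G F'"
  by (auto simp: ends_def)

lemma branching_subset: "branching G F \<Longrightarrow> F' \<subseteq> F \<Longrightarrow> branching G F'"
  unfolding branching_def by (meson acyclic_subset ends_mono inj_on_subset)

text \<open>With indegrees at most 1, walking backwards along arcs is deterministic.\<close>

lemma single_valued_ends_converse: "inj_on (head G) F \<Longrightarrow> single_valued ((ends G F)\<inverse>)"
  by (auto simp: single_valued_def ends_def inj_on_def)

lemma ends_rtrancl_root:
  "(x, r) \<in> (ends G F)\<^sup>* \<Longrightarrow> r \<notin> head G ` F \<Longrightarrow> x = r"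
  by (induct rule: rtrancl_induct) (auto simp: ends_def)

text \<open>Both roots lie on the deterministic backward walk from \<open>i\<close>, so one of them
  reaches the other. No arc enters a root, so the two coincide.\<close>

lemma branching_root_unique:
  assumes "branching G F" "r \<notin> head G ` F" "s \<notin> head G ` F"
    and "(r, i) \<in> (ends G F)\<^sup>*" "(s, i) \<in> (ends G F)\<^sup>*"
  shows "r = s"
proof -
  have "(i, r) \<in> ((ends G F)\<inverse>)\<^sup>*" "(i, s) \<in> ((ends G F)\<inverse>)\<^sup>*"
    using assms by (simp_all add: rtrancl_converse)
  then have "(r, s) \<in> ((ends G F)\<inverse>)\<^sup>* \<or> (s, r) \<in> ((ends G F)\<inverse>)\<^sup>*"
    using assms(1) by (metis branching_def single_valued_confluent single_valued_ends_converse)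
  then show ?thesis
    using assms(2,3) by (auto simp: rtrancl_converse dest: ends_rtrancl_root)
qed

lemma (in wf_digraph) ends_rtrancl_in_verts:
  assumes "F \<subseteq> arcs G" "(x, y) \<in> (ends G F)\<^sup>*"
  shows "y \<in> verts G \<Longrightarrow> x \<in> verts G" "x \<in> verts G \<Longrightarrow> y \<in> verts G"
  using assms(2) assms(1) by (induct rule: rtrancl_induct) (auto simp: ends_def)

lemma (in fin_digraph) finite_branchings [simp]: "finite (branchings G)"
  by (rule finite_subset[of _ "Pow (arcs G)"]) (auto simp: branchings_def)

text \<open>A finite acyclic relation is well-founded, so the backward walk from \<open>i\<close>
  stops, and it can stop only at a root.\<close>

lemma (in fin_digraph) branching_root_exists:
  assumes "F \<in> branchings G" "i \<in> verts G"
  shows "\<exists>r \<in> verts G - head G ` F. (r, i) \<in> (ends G F)\<^sup>*"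
proof -
  have "F \<subseteq> arcs G" "acyclic (ends G F)"
    using assms by (auto simp: branchings_def branching_def)
  then have "wf (ends G F)"
    by (intro finite_acyclic_wf) (metis ends_def finite_arcs finite_imageI finite_subset)
  then show ?thesis using \<open>i \<in> verts G\<close>
  proof (induct i rule: wf_induct_rule)
    case (less i)
    show ?case
    proof (cases "i \<in> head G ` F")
      case True
      then obtain e where e: "e \<in> F" "head G e = i" by auto
      then have step: "(tail G e, i) \<in> ends G F" by (auto simp: ends_def)
      moreover have "tail G e \<in> verts G" using e \<open>F \<subseteq> arcs G\<close> by auto
      ultimately obtain r where "r \<in> verts G - head G ` F" "(r, tail G e) \<in> (ends G F)\<^sup>*"
        using less.hyps by blast
      then show ?thesis using step by (meson rtrancl.rtrancl_into_rtrancl)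
    qed (use less.prems in auto)
  qed
qed

text \<open>Arcs correspond to their heads, which are the non-roots. Maximizing the number of arcs
  thus means minimizing the number of roots.\<close>

lemma (in fin_digraph) card_branching_roots:
  assumes "F \<in> branchings G"
  shows "card F + card (verts G - head G ` F) = card (verts G)"
proof -
  have "head G ` F \<subseteq> verts G" "card (head G ` F) = card F"
    using assms by (auto simp: branchings_def branching_def card_image)
  then show ?thesis
    by (metis card_Diff_subset card_mono finite_subset finite_verts le_add_diff_inverse)
qed

text \<open>A shortest-path forest: every vertex outside \<open>S\<close> chooses one arc of
  \<open>B\<close> coming from a vertex closer to \<open>S\<close>.\<close>

lemma (in fin_digraph) ex_branching_with_roots:
  assumes "B \<subseteq> arcs G" "S \<subseteq> verts G"
    and reach: "\<And>v. v \<in> verts G \<Longrightarrow> \<exists>s\<in>S. (s, v) \<in> (ends G B)\<^sup>*"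
  shows "\<exists>F \<in> branchings G. F \<subseteq> B \<and> verts G - head G ` F = S"
proof -
  \<comment> \<open>Distance of \<open>v\<close> from \<open>S\<close> along arcs of
    \<open>B\<close>.\<close>
  define d where "d v = (LEAST k. \<exists>s\<in>S. (s, v) \<in> ends G B ^^ k)" for v
  have "\<exists>e\<in>B. head G e = v \<and> d (tail G e) < d v" if "v \<in> verts G - S" for v
  proof -
    have "\<exists>k. \<exists>s\<in>S. (s, v) \<in> ends G B ^^ k"
      using reach that by (metis DiffD1 rtrancl_imp_relpow)
    then have "\<exists>s\<in>S. (s, v) \<in> ends G B ^^ d v"
      unfolding d_def by (rule LeastI_ex)
    then obtain s where s: "s \<in> S" "(s, v) \<in> ends G B ^^ d v" by blast
    have "d v \<noteq> 0"
    proof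
      assume "d v = 0"
      then show False using s that by auto
    qed
    then obtain k where k: "d v = Suc k"
      using not0_implies_Suc by blast
    then obtain u where u: "(s, u) \<in> ends G B ^^ k" "(u, v) \<in> ends G B"
      using s by auto
    then have "d u \<le> k"
      unfolding d_def using s(1) by (intro Least_le) blast
    then show ?thesis using u(2) k by (auto simp: ends_def)
  qed
  then obtain f where f: "\<And>v. v \<in> verts G - S \<Longrightarrow>
      f v \<in> B \<and> head G (f v) = v \<and> d (tail G (f v)) < d v"
    by metis
  define F where "F = f ` (verts G - S)"
  have "F \<subseteq> B" using f by (auto simp: F_def)
  have "inj_on (head G) F" unfolding F_def inj_on_def using f by fastforce
  \<comment> \<open>The distance strictly increases along every chosen arc.\<close>
  moreover have "acyclic (ends G F)"
  proof (rule acyclic_subset)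
    show "ends G F \<subseteq> measure d" using f by (auto simp: ends_def F_def)
  qed (simp add: wf_acyclic)
  moreover have "head G ` F = verts G - S" using f by (force simp: F_def image_iff)
  ultimately show ?thesis
    using \<open>F \<subseteq> B\<close> assms(1,2)
    by (intro bexI[of _ F]) (auto simp: branchings_def branching_def)
qed

lemma (in fin_digraph) max_branchings_nonempty: "max_branchings G \<noteq> {}"
proof -
  have "{} \<in> branchings G" by (auto simp: branchings_def branching_def ends_def acyclic_def)
  then have "\<exists>F\<in>branchings G. \<forall>F'\<in>branchings G. card F' \<le> card F"
    using Max_in[of "card ` branchings G"] Max_ge[of "card ` branchings G"] by fastforce
  then show ?thesis by (auto simp: max_branchings_def)
qed

section \<open>Maximum branchings and undominated knots\<close>

lemma knot_nonempty: "undominated_knot G K \<Longrightarrow> K \<noteq> {}"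
  by (simp add: undominated_knot_def)

lemma knot_subset_verts: "undominated_knot G K \<Longrightarrow> K \<subseteq> verts G"
  by (simp add: undominated_knot_def)

text \<open>Backward induction along the path: no arc enters \<open>K\<close> from outside.\<close>

lemma knot_backward_closed:
  assumes "undominated_knot G K" "wf_digraph G" "(u, w) \<in> (arcs_ends G)\<^sup>*" "w \<in> K"
  shows "u \<in> K"
  using assms(3,4)
proof (induct rule: converse_rtrancl_induct)
  case (step x y)
  then show ?case
    using assms(1,2) by (meson DiffI undominated_knot_def wf_digraph.adj_in_verts(1))
qed

lemma knot_reachable:
  assumes "undominated_knot G K" "u \<in> K" "w \<in> K"
  shows "(u, w) \<in> (arcs_ends G)\<^sup>*"
  using assms by (auto simp: undominated_knot_def dest: reachable_rtranclI)

text \<open>All vertices of either knot reach the shared vertex \<open>u\<close>, and the other knot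
  is closed under predecessors, so each contains the other.\<close>

lemma knots_disjoint:
  assumes "undominated_knot G K" "undominated_knot G K'" "wf_digraph G" "u \<in> K" "u \<in> K'"
  shows "K = K'"
  using assms by (meson knot_backward_closed knot_reachable subsetI subset_antisym)

text \<open>Among the ancestors of \<open>v\<close>, one with the fewest ancestors is taken; its
  ancestor set is the knot.\<close>

lemma (in fin_digraph) ex_knot_reaching:
  assumes "v \<in> verts G"
  shows "\<exists>K u. undominated_knot G K \<and> u \<in> K \<and> (u, v) \<in> (arcs_ends G)\<^sup>*"
proof -
  define anc where "anc u = {w \<in> verts G. w \<rightarrow>\<^sup>* u}" for u
  obtain u where u: "u \<in> anc v" and least: "\<And>w. w \<in> anc v \<Longrightarrow> card (anc u) \<le> card (anc w)"
    using ex_has_least_nat[of "\<lambda>u. u \<in> anc v" v "\<lambda>u. card (anc u)"] assms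
    by (auto simp: anc_def)
  \<comment> \<open>Transitivity gives \<open>anc w \<subseteq> anc u\<close>, and minimality of
    \<open>u\<close> excludes a proper inclusion. Hence any two members of \<open>anc u\<close>
    reach each other.\<close>
  have "anc w = anc u" if "w \<in> anc u" for w
  proof (rule card_seteq)
    show "anc w \<subseteq> anc u" using that by (auto simp: anc_def intro: reachable_trans)
    show "card (anc u) \<le> card (anc w)"
      using that u by (intro least) (auto simp: anc_def intro: reachable_trans)
  qed (simp add: anc_def)
  note anc_eq = this
  have "u \<in> verts G" "u \<rightarrow>\<^sup>* v" using u by (simp_all add: anc_def)
  then have "u \<in> anc u" by (simp add: anc_def)
  have "undominated_knot G (anc u)"
    unfolding undominated_knot_def
  proof (intro conjI ballI)
    fix x w assume "x \<in> anc u" "w \<in> anc u"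
    then have "x \<in> anc w" using anc_eq by blast
    then show "x \<rightarrow>\<^sup>* w" by (simp add: anc_def)
  next
    fix x w assume "x \<in> verts G - anc u" "w \<in> anc u"
    then show "\<not> x \<rightarrow> w" unfolding anc_def using adj_reachable_trans by blast
  qed (use \<open>u \<in> anc u\<close> in \<open>auto simp: anc_def\<close>)
  then show ?thesis using \<open>u \<in> anc u\<close> reachable_rtranclI[OF \<open>u \<rightarrow>\<^sup>* v\<close>] by blast
qed

text \<open>The root above any vertex of \<open>K\<close> reaches \<open>K\<close>, hence lies in
  \<open>K\<close> by backward closure.\<close>

lemma (in fin_digraph) knot_contains_root:
  assumes "undominated_knot G K" "F \<in> branchings G"
  shows "\<exists>r\<in>K. r \<notin> head G ` F"
proof -
  obtain k where k: "k \<in> K" "k \<in> verts G" using assms(1) by (auto simp: undominated_knot_def)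
  then obtain r where r: "r \<in> verts G - head G ` F" "(r, k) \<in> (ends G F)\<^sup>*"
    using branching_root_exists assms(2) by blast
  have "ends G F \<subseteq> arcs_ends G"
    using assms(2) ends_mono[of F "arcs G" G] by (auto simp: arcs_ends_eq_ends branchings_def)
  then have "(r, k) \<in> (arcs_ends G)\<^sup>*" using r(2) rtrancl_mono by blast
  then have "r \<in> K" using knot_backward_closed[OF assms(1) wf_digraph] k(1) by blast
  then show ?thesis using r by auto
qed

lemma (in fin_digraph) max_branching_of_card_roots:
  assumes "F \<in> max_branchings G" "F' \<in> branchings G"
    and "card (verts G - head G ` F') \<le> card (verts G - head G ` F)"
  shows "F' \<in> max_branchings G"
proof -
  have "card F + card (verts G - head G ` F) = card F' + card (verts G - head G ` F')"
    using assms card_branching_roots by (simp add: max_branchings_def)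
  then have "card F \<le> card F'" using assms(3) by linarith
  then show ?thesis using assms by (force simp: max_branchings_def)
qed

text \<open>One root of \<open>F\<close> is selected in each knot. Some branching has exactly these
  selected roots, so if \<open>F\<close> had any further root it would have fewer arcs than that
  branching.\<close>

lemma (in fin_digraph) max_branching_roots:
  assumes "F \<in> max_branchings G"
  shows "undominated_knot G K \<Longrightarrow> \<exists>!r. r \<in> K \<and> r \<notin> head G ` F"
    and "verts G - head G ` F \<subseteq> knot_verts G"
proof -
  have F: "F \<in> branchings G" using assms by (simp add: max_branchings_def)
  obtain \<rho> where \<rho>: "\<And>K. undominated_knot G K \<Longrightarrow> \<rho> K \<in> K \<and> \<rho> K \<notin> head G ` F"
    using knot_contains_root[OF _ F] by metis
  define S where "S = {\<rho> K | K. undominated_knot G K}"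
  have S: "S \<subseteq> verts G - head G ` F"
  proof
    fix s assume "s \<in> S"
    then obtain K where "undominated_knot G K" "s = \<rho> K" by (auto simp: S_def)
    then show "s \<in> verts G - head G ` F"
      using \<rho>[of K] knot_subset_verts[of G K] by auto
  qed
  \<comment> \<open>\<open>S\<close> reaches every vertex: some knot reaches it, and the selected
    root reaches all of its knot.\<close>
  have "\<exists>F'\<in>branchings G. F' \<subseteq> arcs G \<and> verts G - head G ` F' = S"
  proof (rule ex_branching_with_roots)
    fix v assume "v \<in> verts G"
    then obtain K u where "undominated_knot G K" "u \<in> K" "(u, v) \<in> (arcs_ends G)\<^sup>*"
      using ex_knot_reaching by blast
    moreover from this have "(\<rho> K, u) \<in> (arcs_ends G)\<^sup>*"
      using \<rho>[of K] knot_reachable[of G K "\<rho> K" u] by blast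
    ultimately show "\<exists>s\<in>S. (s, v) \<in> (ends G (arcs G))\<^sup>*"
      unfolding S_def arcs_ends_eq_ends by (blast intro: rtrancl_trans)
  qed (use S in auto)
  then obtain F' where F': "F' \<in> branchings G" "verts G - head G ` F' = S" by blast
  then have "card F' \<le> card F" using assms by (simp add: max_branchings_def)
  then have "card (verts G - head G ` F) \<le> card S"
    using card_branching_roots[OF F] card_branching_roots[OF F'(1)] F'(2) by simp
  then have roots: "S = verts G - head G ` F"
    using S by (intro card_seteq) auto
  show "verts G - head G ` F \<subseteq> knot_verts G"
    unfolding roots[symmetric] S_def knot_verts_def using \<rho> by blast
  assume K: "undominated_knot G K"
  show "\<exists>!r. r \<in> K \<and> r \<notin> head G ` F"
  proof (rule ex1I)
    show "\<rho> K \<in> K \<and> \<rho> K \<notin> head G ` F" using \<rho> K by blast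
    fix r assume r: "r \<in> K \<and> r \<notin> head G ` F"
    then have "r \<in> S" using knot_subset_verts[OF K] unfolding roots by blast
    then obtain K' where "undominated_knot G K'" "r = \<rho> K'" by (auto simp: S_def)
    then show "r = \<rho> K"
      using r K \<rho>[of K'] knots_disjoint[of G K' K r] wf_digraph by blast
  qed
qed

text \<open>Deleting all arcs that enter the set of vertices reachable from \<open>j\<close> forces \<open>i\<close> into the tree
  of \<open>j\<close>.\<close>

lemma (in fin_digraph) ex_max_branching_reaching:
  assumes K: "undominated_knot G K" "j \<in> K" and ji: "(j, i) \<in> (arcs_ends G)\<^sup>*"
  shows "\<exists>F\<in>max_branchings G. j \<notin> head G ` F \<and> (j, i) \<in> (ends G F)\<^sup>*"
proof -
  obtain F where F: "F \<in> max_branchings G" using max_branchings_nonempty by blast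
  have "F \<in> branchings G" using F by (simp add: max_branchings_def)
  obtain r where r: "r \<in> K" "r \<notin> head G ` F"
    using max_branching_roots(1)[OF F K(1)] by blast
  have r_only: "s = r" if "s \<in> K" "s \<notin> head G ` F" for s
    using max_branching_roots(1)[OF F K(1)] that r by blast
  have KV: "K \<subseteq> verts G" using K by (auto simp: undominated_knot_def)
  \<comment> \<open>The new root set: \<open>j\<close> replaces \<open>r\<close>, the root of
    \<open>F\<close> in \<open>K\<close>, so the number of roots does not grow.\<close>
  define S where "S = insert j (verts G - head G ` F - {r})"
  have S: "S \<subseteq> verts G" using K KV by (auto simp: S_def)
  have cardS: "card S \<le> card (verts G - head G ` F)"
  proof -
    have "card S \<le> Suc (card (verts G - head G ` F - {r}))"
      unfolding S_def by (simp add: card_insert_if)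
    also have "\<dots> = card (verts G - head G ` F)"
      using r KV by (intro card.remove[symmetric]) auto
    finally show ?thesis .
  qed
  define D where "D = {v. (j, v) \<in> (arcs_ends G)\<^sup>*}"
  define B where "B = {e \<in> arcs G. head G e \<in> D \<longrightarrow> tail G e \<in> D}"
  \<comment> \<open>Any other root in \<open>S\<close> that \<open>j\<close> reaches would lie in a
    knot containing \<open>j\<close>, that is in \<open>K\<close>, where \<open>r\<close> was the
    only root of \<open>F\<close>.\<close>
  have S_D: "s = j" if "s \<in> S" "s \<in> D" for s
  proof (rule ccontr)
    assume "s \<noteq> j"
    then have s: "s \<in> verts G" "s \<notin> head G ` F" "s \<noteq> r" using that by (auto simp: S_def)
    then obtain K' where K': "undominated_knot G K'" "s \<in> K'"
      using max_branching_roots(2)[OF F] by (auto simp: knot_verts_def)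
    have "(j, s) \<in> (arcs_ends G)\<^sup>*" using that(2) by (simp add: D_def)
    then have "j \<in> K'" using knot_backward_closed[OF K'(1) wf_digraph] K'(2) by blast
    then have "K' = K" using knots_disjoint[OF K'(1) K(1) wf_digraph] K(2) by blast
    then show False using s K' r_only by blast
  qed
  have D_B: "(j, v) \<in> (ends G B)\<^sup>*" if "(j, v) \<in> (arcs_ends G)\<^sup>*" for v
    using that
  proof (induct rule: rtrancl_induct)
    case (step y z)
    then have "(y, z) \<in> ends G B"
      by (auto simp: B_def D_def ends_def arcs_ends_conv)
    then show ?case using step by (meson rtrancl.rtrancl_into_rtrancl)
  qed simp
  have "\<exists>F'\<in>branchings G. F' \<subseteq> B \<and> verts G - head G ` F' = S"
  proof (rule ex_branching_with_roots)
    fix v assume v: "v \<in> verts G"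
    show "\<exists>s\<in>S. (s, v) \<in> (ends G B)\<^sup>*"
    proof (cases "v \<in> D")
      case True
      then show ?thesis using D_B by (auto simp: D_def S_def)
    next
      case False
      obtain s where s: "s \<in> verts G - head G ` F" "(s, v) \<in> (ends G F)\<^sup>*"
        using branching_root_exists[OF \<open>F \<in> branchings G\<close> v] by blast
      have FA: "ends G F \<subseteq> arcs_ends G"
        using F ends_mono[of F "arcs G" G]
        by (auto simp: arcs_ends_eq_ends branchings_def max_branchings_def)
      \<comment> \<open>\<open>D\<close> is closed under successors, so a path of \<open>F\<close>
        ending outside \<open>D\<close> avoids \<open>D\<close> altogether and uses only arcs of
        \<open>B\<close>.\<close>
      have "(x, v) \<in> (ends G B)\<^sup>* \<and> x \<notin> D" if "(x, v) \<in> (ends G F)\<^sup>*" for x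
        using that
      proof (induct rule: converse_rtrancl_induct)
        case (step y z)
        then have yz: "(y, z) \<in> arcs_ends G" using FA by blast
        then have "y \<notin> D"
          using step unfolding D_def by (meson mem_Collect_eq rtrancl.rtrancl_into_rtrancl)
        moreover have "(y, z) \<in> ends G B"
          using yz step by (auto simp: B_def ends_def arcs_ends_conv)
        ultimately show ?case using step by (meson converse_rtrancl_into_rtrancl)
      qed (use False in auto)
      then have sv: "(s, v) \<in> (ends G B)\<^sup>*" "s \<notin> D" using s by auto
      have "s \<noteq> r"
        using sv K r knot_reachable[OF K(1)] by (auto simp: D_def)
      then show ?thesis using s sv by (auto simp: S_def)
    qed
  qed (use S in \<open>auto simp: B_def\<close>)
  then obtain F' where F': "F' \<in> branchings G" "F' \<subseteq> B" "verts G - head G ` F' = S"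
    by blast
  then have "F' \<in> max_branchings G"
    using max_branching_of_card_roots[OF F] cardS by simp
  moreover have j: "j \<notin> head G ` F'" using F'(3) by (auto simp: S_def)
  moreover have "(j, i) \<in> (ends G F')\<^sup>*"
  proof -
    have "i \<in> verts G"
      using ends_rtrancl_in_verts(2)[of "arcs G" j i] K KV ji by (auto simp: arcs_ends_eq_ends)
    then obtain s where s: "s \<in> S" "(s, i) \<in> (ends G F')\<^sup>*"
      using branching_root_exists[OF F'(1)] F'(3) by blast
    \<comment> \<open>Arcs of \<open>B\<close> do not enter \<open>D\<close> from outside, so the
      path from the root \<open>s\<close> to \<open>i\<close> lies in \<open>D\<close> entirely, and
      \<open>j\<close> is the only root there.\<close>
    have "s \<in> D"
      using s(2) ji
      by (induct rule: converse_rtrancl_induct) (use F'(2) in \<open>auto simp: D_def B_def ends_def\<close>)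
    then show ?thesis using S_D s by blast
  qed
  ultimately show ?thesis by blast
qed

section \<open>Splitting a branching at a knot\<close>

text \<open>A branching with a single root is connected, so these are the arc sets of the spanning
  trees of the knot diverging from \<open>j\<close>.\<close>

definition tree_branchings :: "('a, 'b) pre_digraph \<Rightarrow> 'a set \<Rightarrow> 'a \<Rightarrow> 'b set set" where
  "tree_branchings G K j = {T \<in> branchings (G \<restriction> K). K - head G ` T = {j}}"

lemma ends_remove_knot [simp]: "ends (remove_knot G K) = ends G"
  and branching_remove_knot [simp]: "branching (remove_knot G K) = branching G"
  and verts_remove_knot [simp]: "verts (remove_knot G K) = verts G"
  and tail_remove_knot [simp]: "tail (remove_knot G K) = tail G"
  and head_remove_knot [simp]: "head (remove_knot G K) = head G"
  and arcs_remove_knot: "arcs (remove_knot G K) = arcs G - arcs (G \<restriction> K)"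
  by (simp_all add: remove_knot_def)

lemma (in fin_digraph) fin_digraph_induce: "K \<subseteq> verts G \<Longrightarrow> fin_digraph (G \<restriction> K)"
  by unfold_locales (auto intro: finite_subset)

lemma (in fin_digraph) fin_digraph_remove_knot: "fin_digraph (remove_knot G K)"
  by unfold_locales (auto simp: arcs_remove_knot)

text \<open>Inside this locale the induced subgraph and the remaining digraph are finite digraphs
  too, so all results on branchings apply to both parts.\<close>

locale knot_digraph = fin_digraph +
  fixes K
  assumes knot: "undominated_knot G K"
begin

text \<open>The key to the splitting: whether an arc belongs to the induced part is decided by its
  head alone.\<close>

lemma arc_into_knot: "e \<in> arcs G \<Longrightarrow> head G e \<in> K \<Longrightarrow> e \<in> arcs (G \<restriction> K)"
  using knot_backward_closed[OF knot wf_digraph, of "tail G e" "head G e"]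
  by (auto simp: arcs_ends_conv)

lemma in_verts: "u \<in> K \<Longrightarrow> u \<in> verts G"
  using knot_subset_verts[OF knot] by blast

sublocale KG: fin_digraph "G \<restriction> K"
  using fin_digraph_induce knot_subset_verts[OF knot] .

sublocale RG: fin_digraph "remove_knot G K"
  using fin_digraph_remove_knot .

text \<open>Arcs of \<open>T\<close> have heads in \<open>K\<close> and arcs of \<open>P\<close>
  have heads outside, so heads stay distinct. A path that leaves \<open>K\<close> cannot return, so
  no circuit uses both parts.\<close>

lemma branching_Un:
  assumes T: "T \<in> branchings (G \<restriction> K)" and P: "P \<in> branchings (remove_knot G K)"
  shows "T \<union> P \<in> branchings G" "T \<inter> P = {}" "T = (T \<union> P) \<inter> arcs (G \<restriction> K)"
    "P = (T \<union> P) - arcs (G \<restriction> K)"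
proof -
  have TK: "T \<subseteq> arcs (G \<restriction> K)" and PK: "P \<subseteq> arcs G - arcs (G \<restriction> K)"
    and bT: "branching G T" and bP: "branching G P"
    using assms by (simp_all add: branchings_def arcs_remove_knot)
  show "T \<inter> P = {}" "T = (T \<union> P) \<inter> arcs (G \<restriction> K)" "P = (T \<union> P) - arcs (G \<restriction> K)"
    using TK PK by blast+
  have hP: "head G e \<notin> K" if "e \<in> P" for e
    using that PK arc_into_knot by blast
  have hT: "tail G e \<in> K" "head G e \<in> K" if "e \<in> T" for e
    using that TK by auto
  have "inj_on (head G) (T \<union> P)"
  proof -
    have "head G ` T \<subseteq> K" "head G ` P \<subseteq> - K" using hP hT by auto
    then have "head G ` T \<inter> head G ` P = {}" by blast
    then show ?thesis using bT bP unfolding branching_def inj_on_Un by blast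
  qed
  moreover have "acyclic (ends G (T \<union> P))"
  proof -
    have "T \<subseteq> arcs G" "P \<subseteq> arcs G" using TK PK by auto
    then have "finite T" "finite P" by (simp_all add: finite_subset)
    then have "wf (ends G P)" "wf (ends G T)"
      using bT bP unfolding branching_def by (simp_all add: ends_def finite_acyclic_wf)
    \<comment> \<open>The composition is in fact empty, since arcs of \<open>P\<close> end outside
      \<open>K\<close> and arcs of \<open>T\<close> start in \<open>K\<close>. The inclusion is the
      compatibility condition for uniting well-founded relations.\<close>
    moreover have "ends G P O ends G T \<subseteq> ends G P"
    proof -
      have "Range (ends G P) \<subseteq> - K" "Domain (ends G T) \<subseteq> K"
        using hP hT by (auto simp: ends_def)
      then show ?thesis by blast
    qed
    ultimately have "wf (ends G P \<union> ends G T)" by (rule wf_union_compatible)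
    moreover have "ends G (T \<union> P) = ends G P \<union> ends G T" by (simp add: ends_Un Un_commute)
    ultimately show ?thesis using wf_acyclic by metis
  qed
  ultimately show "T \<union> P \<in> branchings G"
    using TK PK unfolding branchings_def branching_def by auto
qed

lemma branching_restrict:
  assumes "F \<in> branchings G"
  shows "F \<inter> arcs (G \<restriction> K) \<in> branchings (G \<restriction> K)" "F - arcs (G \<restriction> K) \<in> branchings (remove_knot G K)"
proof -
  have F: "F \<subseteq> arcs G" "branching G F" using assms by (simp_all add: branchings_def)
  have "branching G (F \<inter> arcs (G \<restriction> K))" "branching G (F - arcs (G \<restriction> K))"
    by (rule branching_subset[OF F(2)], blast)+
  then show "F \<inter> arcs (G \<restriction> K) \<in> branchings (G \<restriction> K)"
    "F - arcs (G \<restriction> K) \<in> branchings (remove_knot G K)"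
    using F(1) unfolding branchings_def arcs_remove_knot by auto
qed

text \<open>Every branching of the knot has at least one root, and \<open>T\<close> has exactly
  one.\<close>

lemma card_tree_branching_ge:
  assumes "T \<in> tree_branchings G K j" "T' \<in> branchings (G \<restriction> K)"
  shows "card T' \<le> card T"
proof -
  have "T \<in> branchings (G \<restriction> K)" "K - head G ` T = {j}"
    using assms(1) by (simp_all add: tree_branchings_def)
  then have "card T + 1 = card K"
    using KG.card_branching_roots[of T] by simp
  moreover have "card (K - head G ` T') \<ge> 1"
  proof -
    have "j \<in> K" using \<open>K - head G ` T = {j}\<close> by blast
    then have "K - head G ` T' \<noteq> {}"
      using KG.branching_root_exists[OF assms(2), of j] by auto
    then show ?thesis
      using KG.finite_verts by (simp add: Suc_le_eq card_gt_0_iff)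
  qed
  ultimately show ?thesis using KG.card_branching_roots[OF assms(2)] by simp
qed

lemma card_Un_branching:
  assumes "T \<in> branchings (G \<restriction> K)" "P \<in> branchings (remove_knot G K)"
  shows "card (T \<union> P) = card T + card P"
proof (rule card_Un_disjoint)
  show "finite T" using assms(1) finite_subset[OF _ KG.finite_arcs] unfolding branchings_def by blast
  show "finite P" using assms(2) finite_subset[OF _ RG.finite_arcs] unfolding branchings_def by blast
qed (rule branching_Un(2)[OF assms])

text \<open>Arc numbers add over the two parts and \<open>T\<close> is already maximal in the knot,
  so only \<open>P\<close> decides.\<close>

lemma max_branching_Un_iff:
  assumes T: "T \<in> tree_branchings G K j" and P: "P \<in> branchings (remove_knot G K)"
  shows "T \<union> P \<in> max_branchings G \<longleftrightarrow> P \<in> max_branchings (remove_knot G K)"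
proof
  have T': "T \<in> branchings (G \<restriction> K)" using T by (simp add: tree_branchings_def)
  {
    assume "T \<union> P \<in> max_branchings G"
    then have "card (T \<union> P') \<le> card (T \<union> P)" if "P' \<in> branchings (remove_knot G K)" for P'
      using branching_Un(1)[OF T' that] by (simp add: max_branchings_def)
    then show "P \<in> max_branchings (remove_knot G K)"
      using P T' by (simp add: max_branchings_def card_Un_branching)
  next
    assume max: "P \<in> max_branchings (remove_knot G K)"
    have "card F \<le> card (T \<union> P)" if "F \<in> branchings G" for F
    proof -
      note F = branching_restrict[OF that]
      have "card F = card (F \<inter> arcs (G \<restriction> K)) + card (F - arcs (G \<restriction> K))"
        using card_Un_branching[OF F] by (simp add: Int_Diff_Un)
      also have "\<dots> \<le> card T + card P"
        using card_tree_branching_ge[OF T F(1)] F(2) max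
        by (intro add_mono) (simp_all add: max_branchings_def)
      finally show ?thesis using card_Un_branching[OF T' P] by simp
    qed
    then show "T \<union> P \<in> max_branchings G"
      using branching_Un(1)[OF T' P] by (simp add: max_branchings_def)
  }
qed

text \<open>Arcs with head in \<open>K\<close> all lie in the induced part, so restriction keeps the
  roots in \<open>K\<close>, and a maximum branching has just one there.\<close>

lemma max_branching_restrict:
  assumes F: "F \<in> max_branchings G" and j: "j \<in> K" "j \<notin> head G ` F"
  shows "F \<inter> arcs (G \<restriction> K) \<in> tree_branchings G K j"
    "F - arcs (G \<restriction> K) \<in> max_branchings (remove_knot G K)"
proof -
  have FG: "F \<in> branchings G" using F by (simp add: max_branchings_def)
  have "K - head G ` (F \<inter> arcs (G \<restriction> K)) = K - head G ` F"
    using FG arc_into_knot by (force simp: branchings_def)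
  also have "\<dots> = {j}"
    using max_branching_roots(1)[OF F knot] j by blast
  finally show T: "F \<inter> arcs (G \<restriction> K) \<in> tree_branchings G K j"
    using branching_restrict(1)[OF FG] by (simp add: tree_branchings_def)
  show "F - arcs (G \<restriction> K) \<in> max_branchings (remove_knot G K)"
    using max_branching_Un_iff[OF T branching_restrict(2)[OF FG]] F by (simp add: Int_Diff_Un)
qed

text \<open>After its last visit to \<open>K\<close> a path uses only arcs of \<open>P\<close>;
  conversely \<open>j\<close> reaches all of \<open>K\<close> through \<open>T\<close>.\<close>

lemma reachable_Un_iff:
  assumes T: "T \<in> tree_branchings G K j" and P: "P \<in> branchings (remove_knot G K)"
  shows "(j, i) \<in> (ends G (T \<union> P))\<^sup>* \<longleftrightarrow> (\<exists>u\<in>K. (u, i) \<in> (ends G P)\<^sup>*)"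
proof
  have TK: "T \<in> branchings (G \<restriction> K)" "K - head G ` T = {j}"
    using T by (simp_all add: tree_branchings_def)
  {
    assume "(j, i) \<in> (ends G (T \<union> P))\<^sup>*"
    then show "\<exists>u\<in>K. (u, i) \<in> (ends G P)\<^sup>*"
    proof (induct rule: rtrancl_induct)
      case base
      then show ?case using TK(2) by blast
    next
      case (step x y)
      from step(2) consider "(x, y) \<in> ends G T" | "(x, y) \<in> ends G P"
        by (auto simp: ends_Un)
      then show ?case
      proof cases
        case 1
        \<comment> \<open>An arc of \<open>T\<close> leads into \<open>K\<close>, so the path in
          \<open>P\<close> starts afresh at \<open>y\<close>.\<close>
        then have "y \<in> K" using TK(1) by (auto simp: ends_def branchings_def)
        then show ?thesis by blast
      next
        case 2
        then show ?thesis using step(3) by (meson rtrancl.rtrancl_into_rtrancl)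
      qed
    qed
  next
    assume "\<exists>u\<in>K. (u, i) \<in> (ends G P)\<^sup>*"
    then obtain u where u: "u \<in> K" "(u, i) \<in> (ends G P)\<^sup>*" by blast
    then have "(j, u) \<in> (ends G T)\<^sup>*"
      using KG.branching_root_exists[OF TK(1), of u] TK(2) by auto
    then show "(j, i) \<in> (ends G (T \<union> P))\<^sup>*"
      using u(2) by (meson ends_mono rtrancl_mono rtrancl_trans subsetD sup_ge1 sup_ge2)
  }
qed

text \<open>Cutting and gluing at \<open>K\<close> are mutually inverse and multiply weights; this
  is the source of the product formula for the columns indexed by \<open>K\<close>.\<close>

lemma sum_weight_max_branchings_from:
  assumes "j \<in> K"
  shows "(\<Sum>F | F \<in> max_branchings G \<and> j \<notin> head G ` F \<and> (j, i) \<in> (ends G F)\<^sup>*. arcs_weight \<epsilon> G F) =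
    (\<Sum>T\<in>tree_branchings G K j. arcs_weight \<epsilon> G T) *
    (\<Sum>P | P \<in> max_branchings (remove_knot G K) \<and> (\<exists>u\<in>K. (u, i) \<in> (ends G P)\<^sup>*). arcs_weight \<epsilon> G P)"
proof -
  let ?F = "{F \<in> max_branchings G. j \<notin> head G ` F \<and> (j, i) \<in> (ends G F)\<^sup>*}"
  let ?P = "{P \<in> max_branchings (remove_knot G K). \<exists>u\<in>K. (u, i) \<in> (ends G P)\<^sup>*}"
  have "(\<Sum>F\<in>?F. arcs_weight \<epsilon> G F) =
    (\<Sum>(T, P)\<in>tree_branchings G K j \<times> ?P. arcs_weight \<epsilon> G T * arcs_weight \<epsilon> G P)"
  proof (rule sum.reindex_bij_witness[where j = "\<lambda>F. (F \<inter> arcs (G \<restriction> K), F - arcs (G \<restriction> K))"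
        and i = "\<lambda>(T, P). T \<union> P"])
    fix F assume F: "F \<in> ?F"
    then have FG: "F \<in> branchings G" by (simp add: max_branchings_def)
    note TP = max_branching_restrict[of F j] and r = branching_restrict[OF FG]
    show "(F \<inter> arcs (G \<restriction> K), F - arcs (G \<restriction> K)) \<in> tree_branchings G K j \<times> ?P"
    proof -
      have T: "F \<inter> arcs (G \<restriction> K) \<in> tree_branchings G K j" using TP(1) F assms by blast
      have "F - arcs (G \<restriction> K) \<in> max_branchings (remove_knot G K)" using TP(2) F assms by blast
      moreover have "\<exists>u\<in>K. (u, i) \<in> (ends G (F - arcs (G \<restriction> K)))\<^sup>*"
        using reachable_Un_iff[OF T r(2), of i] F unfolding Int_Diff_Un by blast
      ultimately show ?thesis using T by blast
    qed
    show "(case (F \<inter> arcs (G \<restriction> K), F - arcs (G \<restriction> K)) of (T, P) \<Rightarrow> T \<union> P) = F"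
      by (simp add: Int_Diff_Un)
    have "arcs_weight \<epsilon> G (F \<inter> arcs (G \<restriction> K)) * arcs_weight \<epsilon> G (F - arcs (G \<restriction> K)) =
        arcs_weight \<epsilon> G F"
    proof -
      have "finite F" using FG finite_subset[OF _ finite_arcs] unfolding branchings_def by blast
      then show ?thesis unfolding arcs_weight_def by (rule prod.Int_Diff[symmetric])
    qed
    then show "(case (F \<inter> arcs (G \<restriction> K), F - arcs (G \<restriction> K)) of
        (T, P) \<Rightarrow> arcs_weight \<epsilon> G T * arcs_weight \<epsilon> G P) = arcs_weight \<epsilon> G F"
      by simp
  next
    fix TP assume "TP \<in> tree_branchings G K j \<times> ?P"
    then obtain T P where TP: "TP = (T, P)" "T \<in> tree_branchings G K j" "P \<in> ?P" by blast
    then have T: "T \<in> branchings (G \<restriction> K)" "K - head G ` T = {j}"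
      and P: "P \<in> branchings (remove_knot G K)"
      by (simp_all add: tree_branchings_def max_branchings_def)
    show "(case case TP of (T, P) \<Rightarrow> T \<union> P of F \<Rightarrow> (F \<inter> arcs (G \<restriction> K), F - arcs (G \<restriction> K))) = TP"
      using branching_Un(3,4)[OF T(1) P] TP(1) by simp
    \<comment> \<open>Gluing \<open>P\<close> onto \<open>T\<close> therefore cannot destroy the
      root \<open>j\<close>.\<close>
    have "head G e \<notin> K" if "e \<in> P" for e
      using that P arc_into_knot by (auto simp: branchings_def arcs_remove_knot)
    then have "j \<notin> head G ` (T \<union> P)" using T(2) assms by auto
    then show "(case TP of (T, P) \<Rightarrow> T \<union> P) \<in> ?F"
      using max_branching_Un_iff[OF TP(2) P] reachable_Un_iff[OF TP(2) P] TP by simp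
  qed
  also have "\<dots> = (\<Sum>T\<in>tree_branchings G K j. arcs_weight \<epsilon> G T) * (\<Sum>P\<in>?P. arcs_weight \<epsilon> G P)"
    by (simp add: sum_product sum.cartesian_product)
  finally show ?thesis .
qed

text \<open>Some maximum branching has root \<open>j\<close> (the reaching lemma with
  \<open>i = j\<close>); its part inside \<open>K\<close> is the required tree.\<close>

lemma tree_branchings_nonempty:
  assumes "j \<in> K" shows "tree_branchings G K j \<noteq> {}"
proof -
  obtain F where "F \<in> max_branchings G" "j \<notin> head G ` F"
    using ex_max_branching_reaching[OF knot assms, of j] by blast
  then show ?thesis using max_branching_restrict(1)[OF _ assms] by blast
qed

text \<open>Any tree \<open>T\<close> of the knot completes \<open>P\<close> to a maximum branching
  of \<open>G\<close>. The root above \<open>i\<close> lies in some knot reaching \<open>i\<close>,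
  which must be \<open>K\<close>, so this root is that of \<open>T\<close>.\<close>

lemma max_branching_reaches_knot_plus:
  assumes i: "i \<in> knot_plus G K" and P: "P \<in> max_branchings (remove_knot G K)"
  shows "\<exists>u\<in>K. (u, i) \<in> (ends G P)\<^sup>*"
proof -
  obtain j where j: "j \<in> K" using knot by (auto simp: undominated_knot_def)
  then obtain T where T: "T \<in> tree_branchings G K j" using tree_branchings_nonempty by blast
  have PG: "P \<in> branchings (remove_knot G K)" using P by (simp add: max_branchings_def)
  have F: "T \<union> P \<in> max_branchings G" using max_branching_Un_iff[OF T PG] P by simp
  then have FG: "T \<union> P \<in> branchings G" by (simp add: max_branchings_def)
  have iV: "i \<in> verts G" using i by (simp add: knot_plus_def)
  obtain r where r: "r \<in> verts G" "r \<notin> head G ` (T \<union> P)" "(r, i) \<in> (ends G (T \<union> P))\<^sup>*"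
    using branching_root_exists[OF FG iV] by blast
  obtain K' where K': "undominated_knot G K'" "r \<in> K'"
    using max_branching_roots(2)[OF F] r by (auto simp: knot_verts_def)
  have "ends G (T \<union> P) \<subseteq> arcs_ends G"
    using FG ends_mono[of "T \<union> P" "arcs G" G] by (simp add: arcs_ends_eq_ends branchings_def)
  then have "r \<rightarrow>\<^sup>* i" using r(1,3) rtrancl_mono by (auto simp: reachable_conv')
  then have "K' = K" using i K' by (auto simp: knot_plus_def)
  moreover have "K - head G ` (T \<union> P) \<subseteq> {j}"
    using T by (auto simp: tree_branchings_def)
  ultimately have "r = j" using K' r by blast
  then show ?thesis using r(3) reachable_Un_iff[OF T PG] by blast
qed

end

section \<open>Spanning subdigraphs and arc sets\<close>

text \<open>\<open>forest\<close> speaks of cycles given as arc lists; any nonempty closed walk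
  contains such a cycle.\<close>

lemma forest_iff_acyclic:
  assumes "wf_digraph H"
  shows "forest H \<longleftrightarrow> acyclic (arcs_ends H)"
proof -
  interpret wf_digraph H by fact
  have "(\<exists>p. cycle p) \<longleftrightarrow> (\<exists>u. u \<rightarrow>\<^sup>+\<^bsub>H\<^esub> u)"
  proof
    assume "\<exists>p. cycle p"
    then show "\<exists>u. u \<rightarrow>\<^sup>+\<^bsub>H\<^esub> u" unfolding cycle_def reachable1_awalk by blast
  next
    assume "\<exists>u. u \<rightarrow>\<^sup>+\<^bsub>H\<^esub> u"
    then obtain u p where "awalk u p u" "p \<noteq> []" unfolding reachable1_awalk by blast
    then have "closed_w p" by (auto simp: closed_w_def)
    then show "\<exists>p. cycle p" by (rule closed_w_imp_cycle)
  qed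
  then show ?thesis by (simp add: forest_def acyclic_def)
qed

text \<open>A spanning subdigraph shares vertices, tails and heads with \<open>G\<close>, so it is
  determined by its arc set.\<close>

lemma (in wf_digraph) spanning_iff:
  "spanning H G \<longleftrightarrow> (\<exists>F\<subseteq>arcs G. H = G\<lparr>arcs := F\<rparr>)"
proof
  assume "spanning H G"
  then have "H = G\<lparr>arcs := arcs H\<rparr>" "arcs H \<subseteq> arcs G"
    by (auto simp: spanning_def subgraph_def compatible_def)
  then show "\<exists>F\<subseteq>arcs G. H = G\<lparr>arcs := F\<rparr>" by blast
next
  assume "\<exists>F\<subseteq>arcs G. H = G\<lparr>arcs := F\<rparr>"
  then show "spanning H G"
    by (auto simp: spanning_def subgraph_def compatible_def wf_digraph wf_digraph_def
        dest: subsetD)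
qed

context fin_digraph
begin

lemma wf_digraph_arcs_update: "F \<subseteq> arcs G \<Longrightarrow> wf_digraph (G\<lparr>arcs := F\<rparr>)"
  by unfold_locales (auto dest: subsetD)

lemma in_degree_arcs_update: "in_degree (G\<lparr>arcs := F\<rparr>) v = card {e \<in> F. head G e = v}"
  by (simp add: in_degree_def in_arcs_def)

lemma diverging_forest_arcs_update:
  assumes "F \<subseteq> arcs G"
  shows "diverging_forest (G\<lparr>arcs := F\<rparr>) \<longleftrightarrow> branching G F"
proof -
  have fin: "finite F" using assms by (rule finite_subset) simp
  have "(\<forall>v\<in>verts G. card {e \<in> F. head G e = v} \<le> 1) \<longleftrightarrow> inj_on (head G) F"
    using fin
    by (auto simp: card_le_Suc0_iff_eq inj_on_def) (metis assms head_in_verts subsetD)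
  then show ?thesis
    using assms
    by (auto simp: diverging_forest_def branching_def forest_iff_acyclic wf_digraph_arcs_update
        in_degree_arcs_update arcs_ends_eq_ends)
qed

lemma spanning_forests_eq: "spanning_forests G = (\<lambda>F. G\<lparr>arcs := F\<rparr>) ` branchings G"
  by (auto simp: spanning_forests_def spanning_iff branchings_def diverging_forest_arcs_update)

lemma max_out_forests_eq: "max_out_forests G = (\<lambda>F. G\<lparr>arcs := F\<rparr>) ` max_branchings G"
  by (auto simp: max_out_forests_def spanning_forests_eq max_branchings_def)

lemma roots_arcs_update:
  assumes "F \<subseteq> arcs G"
  shows "undominated_verts (G\<lparr>arcs := F\<rparr>) = verts G - head G ` F"
proof -
  have "finite F" using assms by (rule finite_subset) simp
  then show ?thesis by (auto simp: undominated_verts_def in_degree_arcs_update)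
qed

lemma set_weight_arcs_update:
  "set_weight \<epsilon> ((\<lambda>F. G\<lparr>arcs := F\<rparr>) ` X) = (\<Sum>F\<in>X. arcs_weight \<epsilon> G F)"
proof -
  have "inj_on (\<lambda>F. G\<lparr>arcs := F\<rparr>) X"
    by (rule inj_onI) (metis pre_digraph.select_convs(2) pre_digraph.surjective pre_digraph.update_convs(2))
  then show ?thesis
    by (simp add: set_weight_def sum.reindex weight_def arcs_weight_def)
qed

lemma reachable_arcs_update:
  assumes "F \<subseteq> arcs G" "u \<in> verts G"
  shows "u \<rightarrow>\<^sup>*\<^bsub>G\<lparr>arcs := F\<rparr>\<^esub> i \<longleftrightarrow> (u, i) \<in> (ends G F)\<^sup>*"
proof -
  have "u \<in> verts (G\<lparr>arcs := F\<rparr>)" using assms(2) by simp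
  from wf_digraph.reachable_conv'[OF wf_digraph_arcs_update[OF assms(1)] this]
  show ?thesis by (simp add: arcs_ends_eq_ends)
qed

text \<open>Only a step against an arc, from \<open>x\<close> back to \<open>y\<close>, needs an
  argument: \<open>y\<close> is the sole predecessor of \<open>x\<close>, so the path from
  \<open>j\<close> to \<open>x\<close> already passes through \<open>y\<close>.\<close>

lemma weak_component_root:
  assumes F: "F \<in> branchings G" and j: "j \<in> verts G" "j \<notin> head G ` F"
  shows "weak_component (G\<lparr>arcs := F\<rparr>) j = {i. (j, i) \<in> (ends G F)\<^sup>*}"
proof -
  let ?H = "G\<lparr>arcs := F\<rparr>"
  have FA: "F \<subseteq> arcs G" and inj: "inj_on (head G) F"
    using F by (auto simp: branchings_def branching_def)
  interpret H: wf_digraph ?H using FA by (rule wf_digraph_arcs_update)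
  have "(j, i) \<in> (ends G F)\<^sup>*" if "j \<rightarrow>\<^sup>*\<^bsub>with_proj (mk_symmetric ?H)\<^esub> i" for i
    using that unfolding reachable_def
  proof (induct rule: rtrancl_on_induct)
    case (step x y)
    then consider "(x, y) \<in> ends G F" | "(y, x) \<in> ends G F"
      by (auto simp: parcs_mk_symmetric ends_def)
    then show ?case
    proof cases
      case 2
      then have "x \<noteq> j" using j by (auto simp: ends_def)
      then obtain z where z: "(j, z) \<in> (ends G F)\<^sup>*" "(z, x) \<in> ends G F"
        using step by (metis rtranclE)
      then have "z = y" using 2 inj by (auto simp: ends_def inj_on_def)
      then show ?thesis using z by simp
    qed (use step in \<open>meson rtrancl.rtrancl_into_rtrancl\<close>)
  qed simp
  moreover have "j \<rightarrow>\<^sup>*\<^bsub>with_proj (mk_symmetric ?H)\<^esub> i" if "(j, i) \<in> (ends G F)\<^sup>*" for i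
    using that reachable_arcs_update[OF FA j(1)] H.reachable_mk_symmetricI by blast
  ultimately show ?thesis by (auto simp: weak_component_def)
qed

text \<open>A root in the weak component of another root \<open>j\<close> is reached from
  \<open>j\<close>, hence equals \<open>j\<close>. Conversely a single root reaches every
  vertex.\<close>

lemma connected_branching_iff:
  assumes F: "F \<in> branchings G" and "verts G \<noteq> {}"
  shows "Digraph_Component.connected (G\<lparr>arcs := F\<rparr>) \<longleftrightarrow> (\<exists>j. verts G - head G ` F = {j})"
proof
  let ?H = "G\<lparr>arcs := F\<rparr>"
  have FA: "F \<subseteq> arcs G" using F by (simp add: branchings_def)
  {
    assume conn: "Digraph_Component.connected ?H"
    obtain j where j: "j \<in> verts G" "j \<notin> head G ` F"
      using branching_root_exists[OF F] assms(2) by blast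
    have "s = j" if s: "s \<in> verts G" "s \<notin> head G ` F" for s
    proof -
      have "j \<rightarrow>\<^sup>*\<^bsub>with_proj (mk_symmetric ?H)\<^esub> s"
        using conn j s by (auto simp: connected_def strongly_connected_def)
      then have "(j, s) \<in> (ends G F)\<^sup>*"
        using weak_component_root[OF F j] by (auto simp: weak_component_def)
      then show ?thesis using s(2) ends_rtrancl_root by metis
    qed
    then show "\<exists>j. verts G - head G ` F = {j}" using j by blast
  next
    assume "\<exists>j. verts G - head G ` F = {j}"
    then obtain j where j: "verts G - head G ` F = {j}" by blast
    then have jV: "j \<in> verts G" "j \<notin> head G ` F" by auto
    have from_j: "j \<rightarrow>\<^sup>*\<^bsub>with_proj (mk_symmetric ?H)\<^esub> u" if "u \<in> verts G" for u
    proof -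
      have "(j, u) \<in> (ends G F)\<^sup>*" using branching_root_exists[OF F that] j by auto
      then show ?thesis using weak_component_root[OF F jV] by (auto simp: weak_component_def)
    qed
    show "Digraph_Component.connected ?H"
      unfolding connected_def
    proof (rule strongly_connectedI)
      fix u v assume "u \<in> verts (with_proj (mk_symmetric ?H))" "v \<in> verts (with_proj (mk_symmetric ?H))"
      then have "u \<in> verts G" "v \<in> verts G" by simp_all
      then have "u \<rightarrow>\<^sup>*\<^bsub>with_proj (mk_symmetric ?H)\<^esub> j" "j \<rightarrow>\<^sup>*\<^bsub>with_proj (mk_symmetric ?H)\<^esub> v"
        by (blast intro: symmetric_reachable[OF symmetric_mk_symmetric from_j] from_j)+
      then show "u \<rightarrow>\<^sup>*\<^bsub>with_proj (mk_symmetric ?H)\<^esub> v"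
        unfolding reachable_def by (rule rtrancl_on_trans)
    qed (use assms(2) in simp)
  }
qed

end

section \<open>Weights of maximum out forests\<close>

lemma arcs_weight_induce [simp]: "arcs_weight \<epsilon> (G \<restriction> K) = arcs_weight \<epsilon> G"
  and arcs_weight_remove_knot [simp]: "arcs_weight \<epsilon> (remove_knot G K) = arcs_weight \<epsilon> G"
  by (auto simp: arcs_weight_def fun_eq_iff)

text \<open>Double counting: after exchanging the sums, each \<open>F\<close> contributes for
  exactly one index.\<close>

lemma sum_by_unique_index:
  fixes w :: "'f \<Rightarrow> real"
  assumes "finite A" "finite B" and unique: "\<And>F. F \<in> B \<Longrightarrow> \<exists>!j. j \<in> A \<and> P j F"
  shows "(\<Sum>j\<in>A. \<Sum>F | F \<in> B \<and> P j F. w F) = (\<Sum>F\<in>B. w F)"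
proof -
  have "(\<Sum>j\<in>A. \<Sum>F | F \<in> B \<and> P j F. w F) = (\<Sum>j\<in>A. \<Sum>F\<in>B. if P j F then w F else 0)"
    using assms(2) by (simp add: sum.inter_filter)
  also have "\<dots> = (\<Sum>F\<in>B. \<Sum>j\<in>A. if P j F then w F else 0)"
    by (rule sum.swap)
  also have "\<dots> = (\<Sum>F\<in>B. w F)"
  proof (rule sum.cong)
    fix F assume "F \<in> B"
    then obtain r where r: "r \<in> A" "\<And>j. j \<in> A \<Longrightarrow> P j F \<longleftrightarrow> j = r"
      using unique by metis
    then have "(\<Sum>j\<in>A. if P j F then w F else 0) = (\<Sum>j\<in>A. if j = r then w F else 0)"
      by (intro sum.cong refl) simp
    then show "(\<Sum>j\<in>A. if P j F then w F else 0) = w F"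
      using r(1) assms(1) by simp
  qed simp
  finally show ?thesis .
qed

context fin_digraph
begin

lemma finite_max_branchings [simp]: "finite (max_branchings G)"
  by (rule finite_subset[OF _ finite_branchings]) (auto simp: max_branchings_def)

lemma max_branching_card_iff:
  assumes "F \<in> max_branchings G"
  shows "F' \<in> max_branchings G \<longleftrightarrow> F' \<in> branchings G \<and> card F' = card F"
  using assms by (auto simp: max_branchings_def intro: antisym)

text \<open>All maximum branchings have equally many arcs, hence equally many roots, so the definite
  description in \<open>forest_dimension\<close> is well-defined and \<open>n - v\<close> is the
  maximum number of arcs.\<close>

lemma card_max_branching_eq:
  assumes "F \<in> max_branchings G"
  shows "card (verts G) - forest_dimension G = card F"
proof -
  have roots: "card (undominated_verts (G\<lparr>arcs := F'\<rparr>)) = card (verts G) - card F"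
    if "F' \<in> max_branchings G" for F'
  proof -
    have F': "F' \<in> branchings G" "card F' = card F"
      using max_branching_card_iff[OF assms] that by blast+
    then have "F' \<subseteq> arcs G" by (simp add: branchings_def)
    then show ?thesis using card_branching_roots[OF F'(1)] F'(2) by (simp add: roots_arcs_update)
  qed
  have "forest_dimension G = card (verts G) - card F"
    unfolding forest_dimension_def max_out_forests_eq
    by (rule the_equality) (use assms roots in auto)
  \<comment> \<open>This bound makes the truncated subtraction on \<open>nat\<close>
    reversible.\<close>
  moreover have "card F \<le> card (verts G)"
    using card_branching_roots[of F] assms by (simp add: max_branchings_def)
  ultimately show ?thesis by simp
qed

lemma forests_max_eq:
  "forests G (card (verts G) - forest_dimension G) = (\<lambda>F. G\<lparr>arcs := F\<rparr>) ` max_branchings G"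
proof -
  obtain F where F: "F \<in> max_branchings G" using max_branchings_nonempty by blast
  have max: "max_branchings G = {F' \<in> branchings G. card F' = card F}"
    using max_branching_card_iff[OF F] by blast
  show ?thesis
    unfolding forests_def spanning_forests_eq card_max_branching_eq[OF F] max Compr_image_eq
    by simp
qed

lemma set_weight_forests_max:
  "set_weight \<epsilon> (forests G (card (verts G) - forest_dimension G)) =
    (\<Sum>F\<in>max_branchings G. arcs_weight \<epsilon> G F)"
  by (simp add: forests_max_eq set_weight_arcs_update)

lemma forest_matrix_max:
  assumes "j \<in> verts G"
  shows "forest_matrix \<epsilon> G (card (verts G) - forest_dimension G) i j =
    (\<Sum>F | F \<in> max_branchings G \<and> j \<notin> head G ` F \<and> (j, i) \<in> (ends G F)\<^sup>*. arcs_weight \<epsilon> G F)"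
proof -
  have "forests_to G (card (verts G) - forest_dimension G) j i = (\<lambda>F. G\<lparr>arcs := F\<rparr>) `
      {F \<in> max_branchings G. j \<notin> head G ` F \<and> (j, i) \<in> (ends G F)\<^sup>*}"
  proof -
    have "j \<in> undominated_verts (G\<lparr>arcs := F\<rparr>) \<and> i \<in> weak_component (G\<lparr>arcs := F\<rparr>) j \<longleftrightarrow>
        j \<notin> head G ` F \<and> (j, i) \<in> (ends G F)\<^sup>*" if "F \<in> max_branchings G" for F
    proof -
      have F: "F \<in> branchings G" "F \<subseteq> arcs G"
        using that by (simp_all add: max_branchings_def branchings_def)
      show ?thesis
        using weak_component_root[OF F(1) assms] roots_arcs_update[OF F(2)] assms by auto
    qed
    then show ?thesis
      unfolding forests_to_def forests_max_eq Compr_image_eq by (simp cong: conj_cong)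
  qed
  then show ?thesis by (simp add: forest_matrix_def set_weight_arcs_update)
qed

lemma arcs_weight_pos:
  assumes "\<forall>u v. u \<rightarrow> v \<longrightarrow> \<epsilon> u v > 0" "F \<subseteq> arcs G"
  shows "arcs_weight \<epsilon> G F > 0"
  unfolding arcs_weight_def
proof (rule prod_pos)
  fix e assume "e \<in> F"
  then have "(tail G e, head G e) \<in> arcs_ends G" using assms(2) by (auto simp: arcs_ends_conv)
  then show "0 < \<epsilon> (tail G e) (head G e)" using assms(1) by blast
qed

lemma sum_arcs_weight_pos:
  assumes "\<forall>u v. u \<rightarrow> v \<longrightarrow> \<epsilon> u v > 0" "\<And>F. F \<in> X \<Longrightarrow> F \<subseteq> arcs G" "X \<noteq> {}"
  shows "(\<Sum>F\<in>X. arcs_weight \<epsilon> G F) > 0"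
proof (rule sum_pos)
  show "finite X" using assms(2) by (intro finite_subset[of X "Pow (arcs G)"]) auto
qed (use assms arcs_weight_pos in auto)

text \<open>In each maximum branching exactly one root lies above \<open>i\<close>, so row
  \<open>i\<close> counts each branching once.\<close>

lemma sum_forest_matrix_max:
  assumes "i \<in> verts G"
  shows "(\<Sum>j\<in>verts G. forest_matrix \<epsilon> G (card (verts G) - forest_dimension G) i j) =
    set_weight \<epsilon> (forests G (card (verts G) - forest_dimension G))"
proof -
  have "(\<Sum>j\<in>verts G. \<Sum>F | F \<in> max_branchings G \<and> j \<notin> head G ` F \<and> (j, i) \<in> (ends G F)\<^sup>*.
      arcs_weight \<epsilon> G F) = (\<Sum>F\<in>max_branchings G. arcs_weight \<epsilon> G F)"
  proof (rule sum_by_unique_index)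
    fix F assume "F \<in> max_branchings G"
    then have F: "F \<in> branchings G" "branching G F" by (simp_all add: max_branchings_def branchings_def)
    show "\<exists>!j. j \<in> verts G \<and> j \<notin> head G ` F \<and> (j, i) \<in> (ends G F)\<^sup>*"
      using branching_root_exists[OF F(1) assms] branching_root_unique[OF F(2)] by blast
  qed simp_all
  then show ?thesis by (simp add: forest_matrix_max set_weight_forests_max)
qed

text \<open>With positive weights the entry vanishes exactly when no maximum branching has root
  \<open>j\<close> above \<open>i\<close>.\<close>

lemma forest_matrix_max_nonzero_iff:
  assumes pos: "\<forall>u v. u \<rightarrow> v \<longrightarrow> \<epsilon> u v > 0" and j: "j \<in> verts G"
  shows "forest_matrix \<epsilon> G (card (verts G) - forest_dimension G) i j \<noteq> 0 \<longleftrightarrow>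
    j \<in> knot_verts G \<and> j \<rightarrow>\<^sup>* i"
proof
  let ?X = "{F \<in> max_branchings G. j \<notin> head G ` F \<and> (j, i) \<in> (ends G F)\<^sup>*}"
  have XA: "F \<subseteq> arcs G" if "F \<in> ?X" for F
    using that by (simp add: max_branchings_def branchings_def)
  {
    assume "forest_matrix \<epsilon> G (card (verts G) - forest_dimension G) i j \<noteq> 0"
    then have "sum (arcs_weight \<epsilon> G) ?X \<noteq> 0" by (simp add: forest_matrix_max j)
    then have "?X \<noteq> {}" by (metis sum.empty)
    then obtain F where F: "F \<in> ?X" by blast
    then have "j \<in> knot_verts G" using max_branching_roots(2) j by blast
    moreover have "(j, i) \<in> (arcs_ends G)\<^sup>*"
      using F rtrancl_mono[OF ends_mono[OF XA[OF F], of G]] by (auto simp: arcs_ends_eq_ends)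
    ultimately show "j \<in> knot_verts G \<and> j \<rightarrow>\<^sup>* i" using j by (simp add: reachable_conv')
  next
    assume "j \<in> knot_verts G \<and> j \<rightarrow>\<^sup>* i"
    then obtain K where "undominated_knot G K" "j \<in> K" "(j, i) \<in> (arcs_ends G)\<^sup>*"
      by (auto simp: knot_verts_def dest: reachable_rtranclI)
    then have "?X \<noteq> {}" using ex_max_branching_reaching by blast
    then have "sum (arcs_weight \<epsilon> G) ?X > 0" using XA by (intro sum_arcs_weight_pos[OF pos])
    then show "forest_matrix \<epsilon> G (card (verts G) - forest_dimension G) i j \<noteq> 0"
      by (simp add: forest_matrix_max j)
  }
qed

lemma forest_matrix_max_nonneg:
  assumes "\<forall>u v. u \<rightarrow> v \<longrightarrow> \<epsilon> u v > 0" "j \<in> verts G"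
  shows "forest_matrix \<epsilon> G (card (verts G) - forest_dimension G) i j \<ge> 0"
  unfolding forest_matrix_max[OF assms(2)]
proof (rule sum_nonneg)
  fix F assume "F \<in> {F \<in> max_branchings G. j \<notin> head G ` F \<and> (j, i) \<in> (ends G F)\<^sup>*}"
  then have "F \<subseteq> arcs G" by (simp add: max_branchings_def branchings_def)
  then show "0 \<le> arcs_weight \<epsilon> G F" using arcs_weight_pos[OF assms(1)] less_imp_le by blast
qed

lemma set_weight_forests_max_pos:
  assumes "\<forall>u v. u \<rightarrow> v \<longrightarrow> \<epsilon> u v > 0"
  shows "set_weight \<epsilon> (forests G (card (verts G) - forest_dimension G)) > 0"
  unfolding set_weight_forests_max
proof (rule sum_arcs_weight_pos[OF assms])
  fix F assume "F \<in> max_branchings G"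
  then show "F \<subseteq> arcs G" by (simp add: max_branchings_def branchings_def)
qed (rule max_branchings_nonempty)

text \<open>Makes the claim on undominated vertices a case of the diagonal sum over a knot.\<close>

lemma undominated_knot_singleton:
  assumes "j \<in> undominated_verts G"
  shows "undominated_knot G {j}"
proof -
  have "card (in_arcs G j) = 0" and j: "j \<in> verts G"
    using assms unfolding undominated_verts_def in_degree_def by blast+
  then have "in_arcs G j = {}" using finite_in_arcs card_0_eq by blast
  then have "\<not> u \<rightarrow> j" for u by (auto simp: arcs_ends_conv in_arcs_def)
  then show ?thesis unfolding undominated_knot_def using reachable_refl[OF j] j by blast
qed

end

section \<open>Factorization of forest weights at an undominated knot\<close>

context knot_digraph
begin

lemma knot_trees_eq:
  "knot_trees G K = (\<lambda>F. (G \<restriction> K)\<lparr>arcs := F\<rparr>) ` {T \<in> branchings (G \<restriction> K). \<exists>j. K - head G ` T = {j}}"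
proof -
  let ?g = "\<lambda>F. (G \<restriction> K)\<lparr>arcs := F\<rparr>"
  have "verts (G \<restriction> K) \<noteq> {}" using knot_nonempty[OF knot] by simp
  then have conn: "Digraph_Component.connected (?g F) \<longleftrightarrow> (\<exists>j. K - head G ` F = {j})"
    if "F \<in> branchings (G \<restriction> K)" for F
    using KG.connected_branching_iff[OF that] unfolding induce_subgraph_verts induce_subgraph_head
    by blast
  have "knot_trees G K = {H \<in> spanning_forests (G \<restriction> K). Digraph_Component.connected H}"
    unfolding knot_trees_def spanning_forests_def diverging_tree_def by blast
  also have "\<dots> = {H \<in> ?g ` branchings (G \<restriction> K). Digraph_Component.connected H}"
    by (simp only: KG.spanning_forests_eq)
  also have "\<dots> = ?g ` {T \<in> branchings (G \<restriction> K). \<exists>j. K - head G ` T = {j}}"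
    using conn by blast
  finally show ?thesis .
qed

lemma set_weight_knot_trees_from:
  "set_weight \<epsilon> (knot_trees_from G K j) = (\<Sum>T\<in>tree_branchings G K j. arcs_weight \<epsilon> G T)"
proof -
  let ?g = "\<lambda>F. (G \<restriction> K)\<lparr>arcs := F\<rparr>"
  have "j \<in> undominated_verts (?g F) \<longleftrightarrow> j \<in> K - head G ` F"
    if "F \<in> branchings (G \<restriction> K)" for F
  proof -
    have "F \<subseteq> arcs (G \<restriction> K)" using that unfolding branchings_def by blast
    then show ?thesis by (simp only: KG.roots_arcs_update induce_subgraph_verts induce_subgraph_head)
  qed
  then have "knot_trees_from G K j =
      ?g ` {T \<in> branchings (G \<restriction> K). (\<exists>k. K - head G ` T = {k}) \<and> j \<in> K - head G ` T}"
    unfolding knot_trees_from_def knot_trees_eq by blast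
  also have "{T \<in> branchings (G \<restriction> K). (\<exists>k. K - head G ` T = {k}) \<and> j \<in> K - head G ` T} =
      tree_branchings G K j"
  proof -
    have "(\<exists>k. A = {k}) \<and> j \<in> A \<longleftrightarrow> A = {j}" for A by blast
    then show ?thesis unfolding tree_branchings_def by (simp only:)
  qed
  finally show ?thesis by (simp only: KG.set_weight_arcs_update arcs_weight_induce)
qed

lemma set_weight_knot_trees:
  "set_weight \<epsilon> (knot_trees G K) = (\<Sum>j\<in>K. set_weight \<epsilon> (knot_trees_from G K j))"
proof -
  let ?B = "{T \<in> branchings (G \<restriction> K). \<exists>j. K - head G ` T = {j}}"
  have "tree_branchings G K j = {T \<in> ?B. K - head G ` T = {j}}" for j
    unfolding tree_branchings_def by blast
  then have "(\<Sum>j\<in>K. \<Sum>T\<in>tree_branchings G K j. arcs_weight \<epsilon> G T) =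
      (\<Sum>j\<in>K. \<Sum>T | T \<in> ?B \<and> K - head G ` T = {j}. arcs_weight \<epsilon> G T)"
    by simp
  also have "\<dots> = (\<Sum>T\<in>?B. arcs_weight \<epsilon> G T)"
  proof (rule sum_by_unique_index)
    fix T assume "T \<in> ?B"
    then obtain j where "K - head G ` T = {j}" by blast
    then show "\<exists>!j. j \<in> K \<and> K - head G ` T = {j}" by (intro ex1I[of _ j]) auto
  next
    show "finite K" using KG.finite_verts by simp
    show "finite ?B" by simp
  qed
  finally show ?thesis
    by (simp only: set_weight_knot_trees_from knot_trees_eq KG.set_weight_arcs_update
        arcs_weight_induce)
qed

lemma set_weight_max_out_forests_reaching:
  "set_weight \<epsilon> (max_out_forests_reaching G K i) =
    (\<Sum>P | P \<in> max_branchings (remove_knot G K) \<and> (\<exists>u\<in>K. (u, i) \<in> (ends G P)\<^sup>*). arcs_weight \<epsilon> G P)"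
proof -
  have "u \<rightarrow>\<^sup>*\<^bsub>(remove_knot G K)\<lparr>arcs := P\<rparr>\<^esub> i \<longleftrightarrow> (u, i) \<in> (ends G P)\<^sup>*"
    if "P \<in> max_branchings (remove_knot G K)" "u \<in> K" for P u
    using RG.reachable_arcs_update[of P u i] that in_verts
    by (simp add: max_branchings_def branchings_def)
  then have "max_out_forests_reaching G K i = (\<lambda>P. (remove_knot G K)\<lparr>arcs := P\<rparr>) `
      {P \<in> max_branchings (remove_knot G K). \<exists>u\<in>K. (u, i) \<in> (ends G P)\<^sup>*}"
    unfolding max_out_forests_reaching_def RG.max_out_forests_eq Compr_image_eq
    by (simp cong: conj_cong bex_cong)
  then show ?thesis by (simp add: RG.set_weight_arcs_update)
qed

lemma forest_matrix_max_knot: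
  assumes "j \<in> K"
  shows "forest_matrix \<epsilon> G (card (verts G) - forest_dimension G) i j =
    set_weight \<epsilon> (knot_trees_from G K j) * set_weight \<epsilon> (max_out_forests_reaching G K i)"
  unfolding forest_matrix_max[OF in_verts[OF assms]] set_weight_knot_trees_from
    set_weight_max_out_forests_reaching
  by (rule sum_weight_max_branchings_from[OF assms])

lemma set_weight_max_out_forests_reaching_knot_plus:
  assumes "i \<in> knot_plus G K"
  shows "set_weight \<epsilon> (max_out_forests_reaching G K i) =
    set_weight \<epsilon> (max_out_forests (remove_knot G K))"
proof -
  have "{P \<in> max_branchings (remove_knot G K). \<exists>u\<in>K. (u, i) \<in> (ends G P)\<^sup>*} =
      max_branchings (remove_knot G K)"
    using max_branching_reaches_knot_plus[OF assms] by blast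
  then show ?thesis
    by (simp add: set_weight_max_out_forests_reaching RG.max_out_forests_eq
        RG.set_weight_arcs_update)
qed

text \<open>Allows \<open>i = j\<close> in the formula for \<open>knot_plus\<close>, which yields
  the diagonal entries.\<close>

lemma knot_subset_knot_plus: "K \<subseteq> knot_plus G K"
proof
  fix u assume u: "u \<in> K"
  have "K' = K" if "undominated_knot G K'" "x \<in> K'" "x \<rightarrow>\<^sup>* u" for K' x
  proof -
    have "x \<in> K" using knot_backward_closed[OF knot wf_digraph reachable_rtranclI[OF that(3)] u] .
    then show ?thesis using knots_disjoint[OF that(1) knot wf_digraph that(2)] by blast
  qed
  then show "u \<in> knot_plus G K"
    using u in_verts[OF u] unfolding knot_plus_def by blast
qed

text \<open>On the diagonal the reachability condition is trivial, and each maximum branching has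
  exactly one root in \<open>K\<close>.\<close>

lemma sum_forest_matrix_max_knot:
  "(\<Sum>j\<in>K. forest_matrix \<epsilon> G (card (verts G) - forest_dimension G) j j) =
    set_weight \<epsilon> (forests G (card (verts G) - forest_dimension G))"
proof -
  have "(\<Sum>j\<in>K. \<Sum>F | F \<in> max_branchings G \<and> j \<notin> head G ` F. arcs_weight \<epsilon> G F) =
      (\<Sum>F\<in>max_branchings G. arcs_weight \<epsilon> G F)"
    using max_branching_roots(1)[OF _ knot] KG.finite_verts
    by (intro sum_by_unique_index) auto
  then show ?thesis
    by (simp add: forest_matrix_max in_verts set_weight_forests_max)
qed

text \<open>Both sides are the diagonal sum over \<open>K\<close>, whose entries share the factor
  belonging to the remaining digraph.\<close>

lemma set_weight_forests_max_knot:
  "set_weight \<epsilon> (forests G (card (verts G) - forest_dimension G)) =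
    set_weight \<epsilon> (knot_trees G K) * set_weight \<epsilon> (max_out_forests (remove_knot G K))"
proof -
  have "forest_matrix \<epsilon> G (card (verts G) - forest_dimension G) j j =
      set_weight \<epsilon> (knot_trees_from G K j) * set_weight \<epsilon> (max_out_forests (remove_knot G K))"
    if "j \<in> K" for j
    using forest_matrix_max_knot[OF that, of \<epsilon> j] knot_subset_knot_plus that
      set_weight_max_out_forests_reaching_knot_plus[of j \<epsilon>] by auto
  then show ?thesis
    unfolding sum_forest_matrix_max_knot[symmetric] set_weight_knot_trees
    by (simp add: sum_distrib_right)
qed

text \<open>Justifies the division by a tree weight in the ratio of two columns.\<close>

lemma set_weight_knot_trees_from_pos:
  assumes "\<forall>u v. u \<rightarrow> v \<longrightarrow> \<epsilon> u v > 0" "j \<in> K"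
  shows "set_weight \<epsilon> (knot_trees_from G K j) > 0"
  unfolding set_weight_knot_trees_from
proof (rule sum_arcs_weight_pos[OF assms(1)])
  fix T assume "T \<in> tree_branchings G K j"
  then show "T \<subseteq> arcs G" by (auto simp: tree_branchings_def branchings_def)
qed (rule tree_branchings_nonempty[OF assms(2)])

end

theorem theorem2:
  fixes \<Gamma> :: "(nat, 'b) pre_digraph"
    and \<epsilon> :: "nat \<Rightarrow> nat \<Rightarrow> real"
    and n v :: nat
    and K :: "nat set"
    and J :: "nat \<Rightarrow> nat \<Rightarrow> real"
  assumes "digraph \<Gamma>"
    and "verts \<Gamma> = {1..n}"
    and "n > 1"
    and "\<forall>i j. i \<rightarrow>\<^bsub>\<Gamma>\<^esub> j \<longrightarrow> \<epsilon> i j > 0"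
    and "v = forest_dimension \<Gamma>"
    and "undominated_knot \<Gamma> K"
    and "J = (\<lambda>i j. forest_matrix \<epsilon> \<Gamma> (n - v) i j / set_weight \<epsilon> (forests \<Gamma> (n - v)))"
  shows
    "(\<forall>i\<in>{1..n}. (\<forall>j\<in>{1..n}. J i j \<ge> 0) \<and> (\<Sum>k=1..n. J i k) = 1) \<and>
     (\<forall>i\<in>{1..n}. \<forall>j\<in>{1..n}. J i j \<noteq> 0 \<longleftrightarrow> j \<in> knot_verts \<Gamma> \<and> j \<rightarrow>\<^sup>*\<^bsub>\<Gamma>\<^esub> i) \<and>
     (\<forall>j\<in>K.
        (\<forall>i\<in>{1..n}. J i j =
           set_weight \<epsilon> (knot_trees_from \<Gamma> K j) * set_weight \<epsilon> (max_out_forests_reaching \<Gamma> K i)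
             / set_weight \<epsilon> (forests \<Gamma> (n - v))) \<and>
        (\<forall>i\<in>knot_plus \<Gamma> K. J i j = J j j \<and>
           J j j = set_weight \<epsilon> (knot_trees_from \<Gamma> K j) / set_weight \<epsilon> (knot_trees \<Gamma> K))) \<and>
     ((\<Sum>j\<in>K. J j j) = 1 \<and> (\<forall>j\<in>undominated_verts \<Gamma>. J j j = 1)) \<and>
     (\<forall>j\<^sub>1\<in>K. \<forall>j\<^sub>2\<in>K. \<forall>i\<in>{1..n}.
        J i j\<^sub>2 = set_weight \<epsilon> (knot_trees_from \<Gamma> K j\<^sub>2) / set_weight \<epsilon> (knot_trees_from \<Gamma> K j\<^sub>1) * J i j\<^sub>1)"
proof -
  interpret digraph \<Gamma> by fact
  interpret knot_digraph \<Gamma> K by unfold_locales fact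
  note pos = assms(4)
  let ?Q = "forest_matrix \<epsilon> \<Gamma> (n - v)" and ?W = "set_weight \<epsilon> (forests \<Gamma> (n - v))"
    and ?T = "\<lambda>j. set_weight \<epsilon> (knot_trees_from \<Gamma> K j)"
    and ?P = "\<lambda>i. set_weight \<epsilon> (max_out_forests_reaching \<Gamma> K i)"
  have nv: "card (verts \<Gamma>) - forest_dimension \<Gamma> = n - v" using assms(2,5) by simp
  have J: "J i j = ?Q i j / ?W" for i j using assms(7) by simp
  have W: "?W > 0" using set_weight_forests_max_pos[OF pos, unfolded nv] .
  have JK: "J i j = ?T j * ?P i / ?W" if "j \<in> K" for i j
    using forest_matrix_max_knot[OF that, unfolded nv] by (simp add: J)
  \<comment> \<open>The total weight factors as tree weight times remainder weight. As it is
    positive, the remainder factor is nonzero and cancels.\<close>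
  have plus: "J i j = ?T j / set_weight \<epsilon> (knot_trees \<Gamma> K)" if "j \<in> K" "i \<in> knot_plus \<Gamma> K" for i j
    using W unfolding JK[OF that(1)] set_weight_max_out_forests_reaching_knot_plus[OF that(2)]
      set_weight_forests_max_knot[of \<epsilon>, unfolded nv]
    by auto
  \<comment> \<open>Stated for an arbitrary knot \<open>K'\<close>, since an undominated vertex
    \<open>j\<close> uses the knot \<open>{j}\<close> instead of \<open>K\<close>.\<close>
  have diag: "(\<Sum>j\<in>K'. J j j) = 1" if "undominated_knot \<Gamma> K'" for K'
  proof -
    interpret K': knot_digraph \<Gamma> K' by unfold_locales fact
    show ?thesis
      using K'.sum_forest_matrix_max_knot[of \<epsilon>, unfolded nv] W
      by (simp add: J flip: sum_divide_distrib)
  qed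
  show ?thesis
  proof (intro conjI ballI)
    fix i j assume "i \<in> {1..n}" "j \<in> {1..n}"
    then show "0 \<le> J i j"
      using forest_matrix_max_nonneg[OF pos, of j i, unfolded nv] W assms(2) by (simp add: J)
    show "J i j \<noteq> 0 \<longleftrightarrow> j \<in> knot_verts \<Gamma> \<and> j \<rightarrow>\<^sup>*\<^bsub>\<Gamma>\<^esub> i"
      using forest_matrix_max_nonzero_iff[OF pos, of j i, unfolded nv] W assms(2) \<open>j \<in> {1..n}\<close>
      by (simp add: J)
  next
    fix i assume "i \<in> {1..n}"
    then show "(\<Sum>k=1..n. J i k) = 1"
      using sum_forest_matrix_max[of i \<epsilon>, unfolded nv] W assms(2)
      by (simp add: J flip: sum_divide_distrib)
  next
    fix i j assume "j \<in> K" "i \<in> knot_plus \<Gamma> K"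
    moreover from \<open>j \<in> K\<close> have "j \<in> knot_plus \<Gamma> K" using knot_subset_knot_plus by blast
    ultimately show "J i j = J j j" "J j j = ?T j / set_weight \<epsilon> (knot_trees \<Gamma> K)"
      using plus by simp_all
  next
    fix j assume "j \<in> undominated_verts \<Gamma>"
    then show "J j j = 1" using diag[OF undominated_knot_singleton] by simp
  next
    fix j\<^sub>1 j\<^sub>2 i assume "j\<^sub>1 \<in> K" "j\<^sub>2 \<in> K"
    then show "J i j\<^sub>2 = ?T j\<^sub>2 / ?T j\<^sub>1 * J i j\<^sub>1"
      using set_weight_knot_trees_from_pos[OF pos \<open>j\<^sub>1 \<in> K\<close>] by (simp add: JK)
  qed (use JK diag[OF assms(6)] in auto)
qed

end
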